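(* Let $\mathfrak{L}=\bigoplus_{\alpha\in G}\mathfrak{L}_\alpha$ be a Lie algebra over a field $\mathbb{F}$ admitting a regular weakly triangular decomposition $\mathfrak{L}=\mathfrak{L}^-\oplus\mathfrak{h}\oplus\mathfrak{L}^+$ over $G=G_-\cup\{0\}\cup G_+$. Assume that $\mathfrak{L}^+=\bigoplus_{\alpha\in G_+}\mathfrak{L}_\alpha$ is completely self-centralizing. Then $$\mathrm{Der}_{\mathbb{F}}(\mathfrak{L})=\mathrm{Der}_{\mathbb{F}}(\mathfrak{L})_0+\mathrm{Inn}_{\mathbb{F}}(\mathfrak{L}).$$
   Context: A Lie algebra $\mathfrak{L}$ over a field $\mathbb{F}$ admits a weakly triangular decomposition if: (1) $\mathfrak{L}=\mathfrak{L}^-\oplus\mathfrak{h}\oplus\mathfrak{L}^+$ for some subalgebras $\mathfrak{L}^{\pm}$ and $\mathfrak{h}$, where $\mathfrak{h}$ is abelian; (2) $\mathfrak{L}^+\neq0$, $[\mathfrak{h},\mathfrak{L}^+]\subseteq\mathfrak{L}^+$, and $\mathfrak{L}^+$ admits a weight space decomposition relative to $\mathfrak{h}$ (under the adjoint representation) with weights $\alpha\neq0$ lying in a free additive semigroup $G_+\subseteq\mathfrak{h}^*$; (3) there is an anti-involution $\sigma$ on $\mathfrak{L}$ (a linear map with $\sigma([x,y])=[\sigma(y),\sigma(x)]$ and $\sigma^2=\mathrm{id}$) such that $\sigma(\mathfrak{L}^+)=\mathfrak{L}^-$ and $\sigma|_{\mathfrak{h}}=\mathrm{id}_{\mathfrak{h}}$;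 (4) there is a total ordering $>$ on $G_+$ such that for all $\alpha,\beta,\gamma\in G_+$: (a) $\alpha+\beta>\alpha$; and (b) if $\beta\ge\gamma$ then $\alpha+\beta\ge\alpha+\gamma$. For $\alpha\in\mathfrak{h}^*$ let $\mathfrak{L}_\alpha=\{x\in\mathfrak{L}\mid[h,x]=\alpha(h)x\text{ for all }h\in\mathfrak{h}\}$ (possibly $0$); then $\mathfrak{L}_0=\mathfrak{h}$. Let $G_-=\{-\alpha\mid\alpha\in G_+\}$ and $G=G_-\cup\{0\}\cup G_+$, so $\mathfrak{L}^{\pm}=\bigoplus_{\alpha\in G_\pm}\mathfrak{L}_\alpha$ and $\mathfrak{L}=\bigoplus_{\alpha\in G}\mathfrak{L}_\alpha$. The decomposition is regular if all the spaces $\mathfrak{L}_\alpha$ are finite-dimensional. A nonzero element $x$ of a Lie algebra $\mathfrak{K}$ over $\mathbb{F}$ is self-centralizing in $\mathfrak{K}$ if, for $y\in\mathfrak{K}$, $[x,y]=0$ implies $y\in\mathbb{F}x$. A Lie algebra $\mathfrak{K}$ with $\dim\mathfrak{K}>1$ is completely self-centralizing if every nonzero element of $\mathfrak{K}$ is self-centralizing in $\mathfrak{K}$. $\mathrm{Der}_{\mathbb{F}}(\mathfrak{L})$ is the space of $\mathbb{F}$-linear derivations $\mathfrak{L}\to\mathfrak{L}$, and $\mathrm{Inn}_{\mathbb{F}}(\mathfrak{L})$ is its ideal of inner derivations (those of the form $x\mapsto[x,y]$ for some $y\in\mathfrak{L}$). $\mathfrak{L}$ is viewed as graded by the group $\mathfrak{h}^*$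 (with $\mathfrak{L}_\alpha=0$ for $\alpha\notin G$), and $\mathrm{Der}_{\mathbb{F}}(\mathfrak{L})_0$ is the space of derivations of degree $0$, i.e. derivations $\phi$ with $\phi(\mathfrak{L}_\alpha)\subseteq\mathfrak{L}_\alpha$ for all $\alpha\in\mathfrak{h}^*$. *)

theory Defs
  imports Complex_Main "HOL-Library.Multiset" "HOL-Library.Function_Algebras"
begin

locale lie_algebra = vector_space scale
  for scale :: "'f::field \<Rightarrow> 'l::ab_group_add \<Rightarrow> 'l" (infixr \<open>*s\<close> 75) +
  fixes bracket :: "'l \<Rightarrow> 'l \<Rightarrow> 'l"  (\<open>\<lbrakk>_, _\<rbrakk>\<close>)
  assumes bracket_linear_left: "Vector_Spaces.linear (*s) (*s) (\<lambda>x. \<lbrakk>x, y\<rbrakk>)"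
    and bracket_linear_right: "Vector_Spaces.linear (*s) (*s) (\<lambda>y. \<lbrakk>x, y\<rbrakk>)"
    and bracket_self: "\<lbrakk>x, x\<rbrakk> = 0"
    and jacobi: "\<lbrakk>x, \<lbrakk>y, z\<rbrakk>\<rbrakk> + \<lbrakk>y, \<lbrakk>z, x\<rbrakk>\<rbrakk> + \<lbrakk>z, \<lbrakk>x, y\<rbrakk>\<rbrakk> = 0"

text \<open>The free commutative semigroup (without zero) on \<open>B\<close> is the semigroup of nonempty finite
  multisets over \<open>B\<close>.\<close>

definition free_additive_semigroup :: "'a::comm_monoid_add set \<Rightarrow> bool" where
  "free_additive_semigroup S \<longleftrightarrow>
    (\<exists>B. bij_betw sum_mset {M. M \<noteq> {#} \<and> set_mset M \<subseteq> B} S)"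

context lie_algebra
begin

definition subalgebra :: "'l set \<Rightarrow> bool" where
  "subalgebra K \<longleftrightarrow> subspace K \<and> (\<forall>x\<in>K. \<forall>y\<in>K. \<lbrakk>x, y\<rbrakk> \<in> K)"

definition abelian :: "'l set \<Rightarrow> bool" where
  "abelian K \<longleftrightarrow> (\<forall>x\<in>K. \<forall>y\<in>K. \<lbrakk>x, y\<rbrakk> = 0)"

definition finite_dim :: "'l set \<Rightarrow> bool" where
  "finite_dim V \<longleftrightarrow> (\<exists>B. finite B \<and> span B = V)"

definition internal_direct_sum :: "'l set \<Rightarrow> ('i \<Rightarrow> 'l set) \<Rightarrow> 'i set \<Rightarrow> bool" where
  "internal_direct_sum V A I \<longleftrightarrow>
    (\<forall>i\<in>I. subspace (A i)) \<and>
    V = span (\<Union>i\<in>I. A i) \<and>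
    (\<forall>J u. finite J \<and> J \<subseteq> I \<and> (\<forall>i\<in>J. u i \<in> A i) \<and> (\<Sum>i\<in>J. u i) = 0 \<longrightarrow> (\<forall>i\<in>J. u i = 0))"

text \<open>A functional on the subspace \<open>H\<close> is represented by its extension by \<open>0\<close> outside \<open>H\<close> (as a
  function, not a linear extension), so that equality and the pointwise operations on
  \<^typ>\<open>'l \<Rightarrow> 'f\<close> are those of the dual space of \<open>H\<close>.\<close>

definition dual_space :: "'l set \<Rightarrow> ('l \<Rightarrow> 'f) set" where
  "dual_space H = {\<alpha>.
    (\<forall>x\<in>H. \<forall>y\<in>H. \<alpha> (x + y) = \<alpha> x + \<alpha> y) \<and>
    (\<forall>c. \<forall>x\<in>H. \<alpha> (c *s x) = c * \<alpha> x) \<and>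
    (\<forall>x. x \<notin> H \<longrightarrow> \<alpha> x = 0)}"

definition weight_space :: "'l set \<Rightarrow> ('l \<Rightarrow> 'f) \<Rightarrow> 'l set" where
  "weight_space H \<alpha> = {x. \<forall>h\<in>H. \<lbrakk>h, x\<rbrakk> = \<alpha> h *s x}"

definition anti_involution :: "('l \<Rightarrow> 'l) \<Rightarrow> bool" where
  "anti_involution \<sigma> \<longleftrightarrow> Vector_Spaces.linear (*s) (*s) \<sigma> \<and>
    (\<forall>x y. \<sigma> \<lbrakk>x, y\<rbrakk> = \<lbrakk>\<sigma> y, \<sigma> x\<rbrakk>) \<and> \<sigma> \<circ> \<sigma> = id"

text \<open>In the last clause \<open>(\<alpha>, \<beta>) \<in> R\<close> stands for \<open>\<alpha> \<le> \<beta>\<close>.\<close>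

definition weakly_triangular_decomposition ::
  "'l set \<Rightarrow> 'l set \<Rightarrow> 'l set \<Rightarrow> ('l \<Rightarrow> 'f) set \<Rightarrow> bool" where
  "weakly_triangular_decomposition Lm H Lp Gp \<longleftrightarrow>
    (internal_direct_sum UNIV ((!) [Lm, H, Lp]) {..<3} \<and>
      subalgebra Lm \<and> subalgebra H \<and> subalgebra Lp \<and> abelian H) \<and>
    (Lp \<noteq> {0} \<and> (\<forall>h\<in>H. \<forall>x\<in>Lp. \<lbrakk>h, x\<rbrakk> \<in> Lp) \<and>
      Gp \<subseteq> dual_space H \<and> free_additive_semigroup Gp \<and>
      internal_direct_sum Lp (\<lambda>\<alpha>. Lp \<inter> weight_space H \<alpha>) (Gp - {0})) \<and>
    (\<exists>\<sigma>. anti_involution \<sigma> \<and> \<sigma> ` Lp = Lm \<and> (\<forall>h\<in>H. \<sigma> h = h)) \<and>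
    (\<exists>R. linear_order_on Gp R \<and>
      (\<forall>\<alpha>\<in>Gp. \<forall>\<beta>\<in>Gp. (\<alpha>, \<alpha> + \<beta>) \<in> R \<and> \<alpha> + \<beta> \<noteq> \<alpha>) \<and>
      (\<forall>\<alpha>\<in>Gp. \<forall>\<beta>\<in>Gp. \<forall>\<gamma>\<in>Gp. (\<gamma>, \<beta>) \<in> R \<longrightarrow> (\<alpha> + \<gamma>, \<alpha> + \<beta>) \<in> R))"

definition regular_weakly_triangular_decomposition ::
  "'l set \<Rightarrow> 'l set \<Rightarrow> 'l set \<Rightarrow> ('l \<Rightarrow> 'f) set \<Rightarrow> bool" where
  "regular_weakly_triangular_decomposition Lm H Lp Gp \<longleftrightarrow>
    weakly_triangular_decomposition Lm H Lp Gp \<and>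
    (\<forall>\<alpha>\<in>dual_space H. finite_dim (weight_space H \<alpha>))"

definition self_centralizing_in :: "'l set \<Rightarrow> 'l \<Rightarrow> bool" where
  "self_centralizing_in K x \<longleftrightarrow>
    x \<in> K \<and> x \<noteq> 0 \<and> (\<forall>y\<in>K. \<lbrakk>x, y\<rbrakk> = 0 \<longrightarrow> (\<exists>c. y = c *s x))"

text \<open>The first disjunct is needed because \<^const>\<open>dim\<close> is \<open>0\<close> on infinite-dimensional subspaces.\<close>

definition completely_self_centralizing :: "'l set \<Rightarrow> bool" where
  "completely_self_centralizing K \<longleftrightarrow> subalgebra K \<and> (\<not> finite_dim K \<or> dim K > 1) \<and>
    (\<forall>x\<in>K. x \<noteq> 0 \<longrightarrow> self_centralizing_in K x)"

definition Der :: "('l \<Rightarrow> 'l) set" where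
  "Der = {\<phi>. Vector_Spaces.linear (*s) (*s) \<phi> \<and>
    (\<forall>x y. \<phi> \<lbrakk>x, y\<rbrakk> = \<lbrakk>\<phi> x, y\<rbrakk> + \<lbrakk>x, \<phi> y\<rbrakk>)}"

definition Inn :: "('l \<Rightarrow> 'l) set" where
  "Inn = {\<phi>. \<exists>y. \<phi> = (\<lambda>x. \<lbrakk>x, y\<rbrakk>)}"

definition Der0 :: "'l set \<Rightarrow> ('l \<Rightarrow> 'l) set" where
  "Der0 H = {\<phi>\<in>Der. \<forall>\<alpha>\<in>dual_space H. \<phi> ` weight_space H \<alpha> \<subseteq> weight_space H \<alpha>}"

end

end

theory Submission
  imports Defs
begin

text \<open>The adjoint action of \<open>H\<close> diagonalises the whole algebra: on \<open>L\<^sup>+\<close> by assumption, on \<open>L\<^sup>-\<close>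
  because the anti-involution carries weight \<open>\<alpha>\<close> to weight \<open>-\<alpha>\<close>, and on \<open>H\<close> because \<open>H\<close> is
  abelian (\<open>span_weight_spaces_UNIV\<close>). Moreover \<open>H\<close> is finite-dimensional, being contained in the
  weight space of weight \<open>0\<close>.

  Let \<open>\<phi>\<close> be a derivation. Since \<open>H\<close> is abelian, the restriction of \<open>\<phi>\<close> to \<open>H\<close> is a \<open>1\<close>-cocycle:
  \<open>\<lbrakk>h, \<phi> k\<rbrakk> = \<lbrakk>k, \<phi> h\<rbrakk>\<close>. In terms of the components \<open>\<phi>\<^sub>\<alpha>\<close> of weight \<open>\<alpha>\<close> this reads
  \<open>\<alpha>(h) \<phi>\<^sub>\<alpha>(k) = \<alpha>(k) \<phi>\<^sub>\<alpha>(h)\<close>, so for \<open>\<alpha> \<noteq> 0\<close> there is a vector \<open>z\<^sub>\<alpha>\<close> of weight \<open>\<alpha>\<close> with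
  \<open>\<phi>\<^sub>\<alpha>(h) = \<alpha>(h) z\<^sub>\<alpha> = \<lbrakk>h, z\<^sub>\<alpha>\<rbrakk>\<close> for all \<open>h\<close>. As \<open>H\<close> is finite-dimensional, only finitely many
  weights occur, so \<open>z = \<Sum>\<^sub>\<alpha> z\<^sub>\<alpha>\<close> makes sense, and after subtracting the inner derivation of \<open>z\<close> the
  derivation maps \<open>H\<close> into the centralizer of \<open>H\<close> (\<open>cocycle_coboundary_mod_centralizer\<close>). A derivation
  with that property preserves every weight space (\<open>derivation_preserves_weight_space\<close>), that is, it
  has degree \<open>0\<close>.\<close>

context lie_algebra
begin

section \<open>Derivations\<close>

interpretation left: Vector_Spaces.linear scale scale "\<lambda>x. \<lbrakk>x, y\<rbrakk>" for y
  by (rule bracket_linear_left)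

interpretation right: Vector_Spaces.linear scale scale "\<lambda>y. \<lbrakk>x, y\<rbrakk>" for x
  by (rule bracket_linear_right)

lemma bracket_antisym: "\<lbrakk>x, y\<rbrakk> = - \<lbrakk>y, x\<rbrakk>"
proof -
  have "\<lbrakk>x + y, x + y\<rbrakk> = \<lbrakk>x, y\<rbrakk> + \<lbrakk>y, x\<rbrakk>"
    unfolding left.add right.add by (simp add: bracket_self)
  then show ?thesis
    by (simp add: bracket_self eq_neg_iff_add_eq_0)
qed

lemma bracket_leibniz: "\<lbrakk>x, \<lbrakk>y, z\<rbrakk>\<rbrakk> = \<lbrakk>\<lbrakk>x, y\<rbrakk>, z\<rbrakk> + \<lbrakk>y, \<lbrakk>x, z\<rbrakk>\<rbrakk>"
proof -
  have "\<lbrakk>y, \<lbrakk>z, x\<rbrakk>\<rbrakk> = - \<lbrakk>y, \<lbrakk>x, z\<rbrakk>\<rbrakk>"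
    using bracket_antisym[of z x] by (simp add: right.neg)
  moreover have "\<lbrakk>z, \<lbrakk>x, y\<rbrakk>\<rbrakk> = - \<lbrakk>\<lbrakk>x, y\<rbrakk>, z\<rbrakk>"
    by (rule bracket_antisym)
  ultimately have "\<lbrakk>x, \<lbrakk>y, z\<rbrakk>\<rbrakk> - \<lbrakk>y, \<lbrakk>x, z\<rbrakk>\<rbrakk> - \<lbrakk>\<lbrakk>x, y\<rbrakk>, z\<rbrakk> = 0"
    using jacobi[of x y z] by simp
  then show ?thesis
    by (simp add: algebra_simps)
qed

lemma DerD:
  assumes "\<phi> \<in> Der"
  shows "Vector_Spaces.linear (*s) (*s) \<phi>" and "\<phi> \<lbrakk>x, y\<rbrakk> = \<lbrakk>\<phi> x, y\<rbrakk> + \<lbrakk>x, \<phi> y\<rbrakk>"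
  using assms by (auto simp: Der_def)

lemma Inn_subset_Der: "Inn \<subseteq> Der"
proof
  fix \<phi> assume "\<phi> \<in> Inn"
  then obtain z where \<phi>: "\<phi> = (\<lambda>x. \<lbrakk>x, z\<rbrakk>)"
    by (auto simp: Inn_def)
  have "\<lbrakk>\<lbrakk>x, y\<rbrakk>, z\<rbrakk> = \<lbrakk>\<lbrakk>x, z\<rbrakk>, y\<rbrakk> + \<lbrakk>x, \<lbrakk>y, z\<rbrakk>\<rbrakk>" for x y
    using bracket_leibniz[of x y z] bracket_antisym[of "\<lbrakk>x, z\<rbrakk>" y] by simp
  then show "\<phi> \<in> Der"
    using bracket_linear_left by (simp add: Der_def \<phi>)
qed

lemma Der_add:
  assumes "\<phi> \<in> Der" and "\<psi> \<in> Der"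
  shows "\<phi> + \<psi> \<in> Der"
proof -
  interpret vector_space_pair scale scale
    by unfold_locales
  have "Vector_Spaces.linear (*s) (*s) (\<lambda>x. \<phi> x + \<psi> x)"
    using assms by (intro linear_compose_add DerD)
  then show ?thesis
    by (simp add: Der_def plus_fun_def DerD(2)[OF assms(1)] DerD(2)[OF assms(2)]
        left.add right.add)
qed

lemma Der_diff:
  assumes "\<phi> \<in> Der" and "\<psi> \<in> Der"
  shows "\<phi> - \<psi> \<in> Der"
proof -
  interpret vector_space_pair scale scale
    by unfold_locales
  have "Vector_Spaces.linear (*s) (*s) (\<lambda>x. \<phi> x - \<psi> x)"
    using assms by (intro linear_compose_sub DerD)
  then show ?thesis
    by (simp add: Der_def fun_diff_def DerD(2)[OF assms(1)] DerD(2)[OF assms(2)]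
        left.diff right.diff)
qed

section \<open>Weight decompositions\<close>

lemma weight_spaceD: "x \<in> weight_space H \<alpha> \<Longrightarrow> h \<in> H \<Longrightarrow> \<lbrakk>h, x\<rbrakk> = \<alpha> h *s x"
  by (simp add: weight_space_def)

lemma subspace_weight_space: "subspace (weight_space H \<alpha>)"
  by (auto simp: subspace_def weight_space_def right.add right.scale right.zero
      scale_right_distrib mult.commute)

text \<open>Functionals in the dual space vanish outside \<open>H\<close>, so distinct ones are separated by a vector
  of \<open>H\<close>.\<close>

lemma dual_space_separate:
  assumes "\<alpha> \<in> dual_space H" and "\<beta> \<in> dual_space H" and "\<alpha> \<noteq> \<beta>"
  obtains h where "h \<in> H" and "\<alpha> h \<noteq> \<beta> h"
proof -
  from \<open>\<alpha> \<noteq> \<beta>\<close> obtain h where "\<alpha> h \<noteq> \<beta> h"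
    by auto
  moreover from this have "h \<in> H"
    using assms(1,2) by (cases "h \<in> H") (auto simp: dual_space_def)
  ultimately show thesis
    using that by blast
qed

lemma zero_in_dual_space: "0 \<in> dual_space H"
  by (simp add: dual_space_def)

lemma uminus_in_dual_space: "\<alpha> \<in> dual_space H \<Longrightarrow> - \<alpha> \<in> dual_space H"
  by (auto simp: dual_space_def)

text \<open>Applying \<open>\<lbrakk>h, -\<rbrakk> - \<alpha> h\<close> to a relation
  kills the term of weight \<open>\<alpha>\<close> and rescales each other term, of weight \<open>\<beta>\<close>, by \<open>\<beta> h - \<alpha> h\<close>, which is
  nonzero for a suitable \<open>h\<close>.\<close>

lemma weight_vectors_independent:
  assumes "finite J" and "J \<subseteq> dual_space H"
    and "\<And>\<alpha>. \<alpha> \<in> J \<Longrightarrow> u \<alpha> \<in> weight_space H \<alpha>"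
    and "(\<Sum>\<alpha>\<in>J. u \<alpha>) = 0" and "\<alpha> \<in> J"
  shows "u \<alpha> = 0"
  using assms
proof (induction J arbitrary: u \<alpha> rule: finite_induct)
  case empty
  then show ?case by simp
next
  case (insert \<gamma> J)
  have *: "u \<beta> = 0" if "\<beta> \<in> J" for \<beta>
  proof -
    have "\<beta> \<noteq> \<gamma>"
      using that insert.hyps by auto
    moreover have "\<beta> \<in> dual_space H" "\<gamma> \<in> dual_space H"
      using insert.prems(1) that by auto
    ultimately obtain h where h: "h \<in> H" "\<beta> h \<noteq> \<gamma> h"
      by (metis dual_space_separate)
    have eigen: "\<lbrakk>h, u \<alpha>\<rbrakk> = \<alpha> h *s u \<alpha>" if "\<alpha> \<in> insert \<gamma> J" for \<alpha>
      using insert.prems(2)[OF that] h(1) by (rule weight_spaceD)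
    have "(\<Sum>\<alpha>\<in>J. (\<alpha> h - \<gamma> h) *s u \<alpha>) = (\<Sum>\<alpha>\<in>insert \<gamma> J. (\<alpha> h - \<gamma> h) *s u \<alpha>)"
      using insert.hyps by simp
    also have "\<dots> = (\<Sum>\<alpha>\<in>insert \<gamma> J. \<lbrakk>h, u \<alpha>\<rbrakk> - \<gamma> h *s u \<alpha>)"
      by (intro sum.cong refl) (simp only: eigen scale_left_diff_distrib)
    also have "\<dots> = \<lbrakk>h, \<Sum>\<alpha>\<in>insert \<gamma> J. u \<alpha>\<rbrakk> - \<gamma> h *s (\<Sum>\<alpha>\<in>insert \<gamma> J. u \<alpha>)"
      by (simp only: sum_subtractf right.sum scale_sum_right)
    also have "\<dots> = 0"
      using insert.prems(3) by (simp only: right.zero scale_zero_right diff_zero)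
    finally have "(\<Sum>\<alpha>\<in>J. (\<alpha> h - \<gamma> h) *s u \<alpha>) = 0" .
    moreover have "(\<alpha> h - \<gamma> h) *s u \<alpha> \<in> weight_space H \<alpha>" if "\<alpha> \<in> J" for \<alpha>
      using that by (intro subspace_scale[OF subspace_weight_space] insert.prems(2)) simp
    ultimately have "(\<beta> h - \<gamma> h) *s u \<beta> = 0"
      using insert.IH[of "\<lambda>\<alpha>. (\<alpha> h - \<gamma> h) *s u \<alpha>" \<beta>] insert.prems(1) that by simp
    then show ?thesis
      using h(2) by simp
  qed
  then have "u \<gamma> = 0"
    using insert.prems(3) insert.hyps by simp
  with * show ?case
    using insert.prems(4) by auto
qed

text \<open>The components are given as a function on all weights, vanishing outside \<open>S\<close>, so that
  uniqueness is an equation between functions whatever finite sets \<open>S\<close> are used.\<close>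

definition weight_decomposition :: "'l set \<Rightarrow> 'l \<Rightarrow> ('l \<Rightarrow> 'f) set \<Rightarrow> (('l \<Rightarrow> 'f) \<Rightarrow> 'l) \<Rightarrow> bool" where
  "weight_decomposition H x S u \<longleftrightarrow>
    finite S \<and> S \<subseteq> dual_space H \<and> (\<forall>\<alpha>. u \<alpha> \<in> weight_space H \<alpha>) \<and>
    (\<forall>\<alpha>. \<alpha> \<notin> S \<longrightarrow> u \<alpha> = 0) \<and> x = (\<Sum>\<alpha>\<in>S. u \<alpha>)"

lemma weight_decomposition_mono:
  assumes "weight_decomposition H x S u" and "finite T" and "S \<subseteq> T" and "T \<subseteq> dual_space H"
  shows "weight_decomposition H x T u"
proof -
  have "(\<Sum>\<alpha>\<in>S. u \<alpha>) = (\<Sum>\<alpha>\<in>T. u \<alpha>)"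
    using assms by (intro sum.mono_neutral_left) (auto simp: weight_decomposition_def)
  then show ?thesis
    using assms by (auto simp: weight_decomposition_def)
qed

lemma weight_decomposition_bracket:
  assumes "weight_decomposition H x S u" and "h \<in> H"
  shows "weight_decomposition H \<lbrakk>h, x\<rbrakk> S (\<lambda>\<alpha>. \<alpha> h *s u \<alpha>)"
proof -
  have "\<lbrakk>h, u \<alpha>\<rbrakk> = \<alpha> h *s u \<alpha>" for \<alpha>
    using assms by (intro weight_spaceD[of _ H]) (auto simp: weight_decomposition_def)
  then show ?thesis
    using assms
    by (simp add: weight_decomposition_def right.sum subspace_scale[OF subspace_weight_space])
qed

lemma weight_decomposition_unique:
  assumes u: "weight_decomposition H x S u" and v: "weight_decomposition H x T v"
  shows "u = v"
proof
  fix \<alpha>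
  have *: "finite (S \<union> T)" "S \<union> T \<subseteq> dual_space H"
    using u v by (auto simp: weight_decomposition_def)
  have u': "weight_decomposition H x (S \<union> T) u" and v': "weight_decomposition H x (S \<union> T) v"
    using weight_decomposition_mono[OF u *(1) _ *(2)] weight_decomposition_mono[OF v *(1) _ *(2)]
    by auto
  show "u \<alpha> = v \<alpha>"
  proof (cases "\<alpha> \<in> S \<union> T")
    case True
    have "(\<Sum>\<alpha>\<in>S \<union> T. u \<alpha> - v \<alpha>) = 0"
      using u' v' by (simp add: sum_subtractf weight_decomposition_def)
    then have "u \<alpha> - v \<alpha> = 0"
      using u v True * weight_vectors_independent[of "S \<union> T" H "\<lambda>\<alpha>. u \<alpha> - v \<alpha>" \<alpha>]
      by (auto simp: weight_decomposition_def intro!: subspace_diff[OF subspace_weight_space])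
    then show ?thesis by simp
  next
    case False
    then show ?thesis
      using u v by (auto simp: weight_decomposition_def)
  qed
qed

lemma weight_decomposition_exists:
  assumes "x \<in> span (\<Union>\<alpha>\<in>dual_space H. weight_space H \<alpha>)"
  shows "\<exists>S u. weight_decomposition H x S u"
  using assms
proof (induction rule: span_induct_alt)
  case base
  have "weight_decomposition H 0 {} (\<lambda>_. 0)"
    by (simp add: weight_decomposition_def subspace_0 subspace_weight_space)
  then show ?case by blast
next
  case (step c x y)
  then obtain \<alpha> S u where \<alpha>: "\<alpha> \<in> dual_space H" "x \<in> weight_space H \<alpha>"
    and u: "weight_decomposition H y S u"
    by auto
  let ?S = "insert \<alpha> S" and ?v = "\<lambda>\<beta>. if \<beta> = \<alpha> then c *s x else 0"
  have S: "finite ?S" "?S \<subseteq> dual_space H"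
    using u \<alpha> by (auto simp: weight_decomposition_def)
  have "weight_decomposition H y ?S u"
    using weight_decomposition_mono[OF u S(1) _ S(2)] by auto
  moreover have "(\<Sum>\<beta>\<in>?S. ?v \<beta>) = c *s x"
    using S(1) by (simp add: sum.delta')
  moreover have "?v \<beta> \<in> weight_space H \<beta>" for \<beta>
    using \<alpha> by (auto intro: subspace_scale[OF subspace_weight_space] subspace_0[OF subspace_weight_space])
  ultimately have "weight_decomposition H (c *s x + y) ?S (\<lambda>\<beta>. ?v \<beta> + u \<beta>)"
    using S unfolding weight_decomposition_def sum.distrib
    by (intro conjI allI impI subspace_add[OF subspace_weight_space]) auto
  then show ?case by blast
qed

section \<open>Derivations modulo inner derivations\<close>

text \<open>The first cohomology of the abelian algebra \<open>H\<close> with coefficients in a weight space of nonzero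
  weight \<open>\<alpha>\<close> vanishes: if \<open>\<alpha> k \<noteq> 0\<close>, a cocycle \<open>c\<close> is the coboundary of \<open>c k\<close> divided by \<open>\<alpha> k\<close>. The
  finite spanning set \<open>B\<close> keeps the number of weights occurring in \<open>c\<close> finite, so that these vectors
  can be added up over all weights.\<close>

lemma cocycle_coboundary_mod_centralizer:
  assumes span: "span (\<Union>\<alpha>\<in>dual_space H. weight_space H \<alpha>) = UNIV"
    and B: "finite B" "B \<subseteq> H" "H \<subseteq> span B"
    and c: "Vector_Spaces.linear (*s) (*s) c"
    and cocycle: "\<And>h k. h \<in> H \<Longrightarrow> k \<in> H \<Longrightarrow> \<lbrakk>h, c k\<rbrakk> = \<lbrakk>k, c h\<rbrakk>"
  obtains z where "\<And>h. h \<in> H \<Longrightarrow> c h - \<lbrakk>h, z\<rbrakk> \<in> weight_space H 0"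
proof -
  have "\<forall>h. \<exists>S u. weight_decomposition H (c h) S u"
    using weight_decomposition_exists span by blast
  then obtain S u where u: "\<And>h. weight_decomposition H (c h) (S h) (u h)"
    by metis
  \<comment> \<open>Both sides of the cocycle identity are sums of weight vectors; comparing the components of
    weight \<open>\<alpha>\<close> shows that \<open>u h \<alpha>\<close> is proportional to \<open>\<alpha> h\<close>.\<close>
  have proportional: "\<alpha> h *s u k \<alpha> = \<alpha> k *s u h \<alpha>" if "h \<in> H" "k \<in> H" for h k \<alpha>
  proof -
    have "weight_decomposition H \<lbrakk>h, c k\<rbrakk> (S h) (\<lambda>\<alpha>. \<alpha> k *s u h \<alpha>)"
      using weight_decomposition_bracket[OF u[of h] that(2)] by (simp add: cocycle[OF that])
    then have "(\<lambda>\<alpha>. \<alpha> h *s u k \<alpha>) = (\<lambda>\<alpha>. \<alpha> k *s u h \<alpha>)"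
      using weight_decomposition_unique[OF weight_decomposition_bracket[OF u[of k] that(1)]]
      by simp
    then show ?thesis
      by (rule fun_cong)
  qed
  have "\<exists>z. z \<in> weight_space H \<alpha> \<and> (\<forall>h\<in>H. u h \<alpha> = \<alpha> h *s z)"
    if \<alpha>: "\<alpha> \<in> dual_space H" "\<alpha> \<noteq> 0" for \<alpha>
  proof -
    obtain k where k: "k \<in> H" "\<alpha> k \<noteq> 0"
      using dual_space_separate[OF \<alpha>(1) zero_in_dual_space \<alpha>(2)] by auto
    let ?z = "inverse (\<alpha> k) *s u k \<alpha>"
    have "?z \<in> weight_space H \<alpha>"
      using u[of k] by (auto simp: weight_decomposition_def
          intro!: subspace_scale[OF subspace_weight_space])
    moreover have "u h \<alpha> = \<alpha> h *s ?z" if "h \<in> H" for h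
    proof -
      have "\<alpha> h *s ?z = inverse (\<alpha> k) *s (\<alpha> h *s u k \<alpha>)"
        by (simp add: mult.commute)
      also have "\<dots> = u h \<alpha>"
        using proportional[OF that k(1), of \<alpha>] k(2) by simp
      finally show ?thesis ..
    qed
    ultimately show ?thesis by blast
  qed
  then obtain zc where zc: "\<And>\<alpha>. \<alpha> \<in> dual_space H \<Longrightarrow> \<alpha> \<noteq> 0 \<Longrightarrow> zc \<alpha> \<in> weight_space H \<alpha>"
    "\<And>\<alpha> h. \<alpha> \<in> dual_space H \<Longrightarrow> \<alpha> \<noteq> 0 \<Longrightarrow> h \<in> H \<Longrightarrow> u h \<alpha> = \<alpha> h *s zc \<alpha>"
    by metis
  define T where "T = (\<Union>b\<in>B. S b)"
  have T: "finite T" "T \<subseteq> dual_space H"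
    using u B(1) by (auto simp: T_def weight_decomposition_def)
  define z where "z = (\<Sum>\<alpha>\<in>T - {0}. zc \<alpha>)"
  have on_B: "c b - \<lbrakk>b, z\<rbrakk> \<in> weight_space H 0" if "b \<in> B" for b
  proof -
    have b: "b \<in> H"
      using that B(2) by auto
    have "weight_decomposition H (c b) (insert 0 T) (u b)"
      using T zero_in_dual_space that
      by (intro weight_decomposition_mono[OF u]) (auto simp: T_def)
    then have "c b = (\<Sum>\<alpha>\<in>insert 0 T. u b \<alpha>)"
      by (simp add: weight_decomposition_def)
    also have "\<dots> = u b 0 + (\<Sum>\<alpha>\<in>T - {0}. u b \<alpha>)"
      using T(1) by (simp add: sum.insert_remove)
    also have "(\<Sum>\<alpha>\<in>T - {0}. u b \<alpha>) = (\<Sum>\<alpha>\<in>T - {0}. \<lbrakk>b, zc \<alpha>\<rbrakk>)"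
      using T(2) b zc by (intro sum.cong) (auto simp: weight_spaceD[OF zc(1)])
    also have "\<dots> = \<lbrakk>b, z\<rbrakk>"
      by (simp add: z_def right.sum)
    finally have "c b - \<lbrakk>b, z\<rbrakk> = u b 0"
      by (simp only: add_diff_cancel_right')
    then show ?thesis
      using u[of b] by (simp add: weight_decomposition_def)
  qed
  interpret vector_space_pair scale scale
    by unfold_locales
  have "Vector_Spaces.linear (*s) (*s) (\<lambda>h. c h - \<lbrakk>h, z\<rbrakk>)"
    by (intro linear_compose_sub c bracket_linear_left)
  then have "subspace ((\<lambda>h. c h - \<lbrakk>h, z\<rbrakk>) -` weight_space H 0)"
    by (rule linear_subspace_vimage) (rule subspace_weight_space)
  then have "span B \<subseteq> (\<lambda>h. c h - \<lbrakk>h, z\<rbrakk>) -` weight_space H 0"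
    using on_B by (intro span_minimal) auto
  then have "c h - \<lbrakk>h, z\<rbrakk> \<in> weight_space H 0" if "h \<in> H" for h
    using that B(3) by blast
  then show thesis
    using that by blast
qed

text \<open>For \<open>x\<close> of weight \<open>\<alpha>\<close>, the Leibniz rule expresses \<open>\<lbrakk>h, \<phi> x\<rbrakk> - \<alpha> h *s \<phi> x\<close> as
  \<open>- \<lbrakk>\<phi> h, x\<rbrakk>\<close>, which again has weight \<open>\<alpha>\<close> because \<open>\<phi> h\<close> commutes with \<open>H\<close>. In weight \<open>\<beta> \<noteq> \<alpha>\<close> the
  component of the left hand side is \<open>\<beta> h - \<alpha> h\<close> times that of \<open>\<phi> x\<close>, and choosing \<open>h\<close> with
  \<open>\<beta> h \<noteq> \<alpha> h\<close> shows that \<open>\<phi> x\<close> has no such component.\<close>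

lemma derivation_preserves_weight_space:
  assumes span: "span (\<Union>\<alpha>\<in>dual_space H. weight_space H \<alpha>) = UNIV"
    and \<phi>: "\<phi> \<in> Der" and central: "\<And>h. h \<in> H \<Longrightarrow> \<phi> h \<in> weight_space H 0"
    and \<alpha>: "\<alpha> \<in> dual_space H" and x: "x \<in> weight_space H \<alpha>"
  shows "\<phi> x \<in> weight_space H \<alpha>"
proof -
  interpret \<phi>: Vector_Spaces.linear scale scale \<phi>
    using DerD(1)[OF \<phi>] .
  obtain S' u where u: "weight_decomposition H (\<phi> x) S' u"
    using weight_decomposition_exists[of "\<phi> x" H] span by auto
  define S where "S = insert \<alpha> S'"
  have u: "weight_decomposition H (\<phi> x) S u"
    using u \<alpha>
    by (intro weight_decomposition_mono[OF u]) (auto simp: S_def weight_decomposition_def)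
  have "u \<beta> = 0" if \<beta>: "\<beta> \<in> S" "\<beta> \<noteq> \<alpha>" for \<beta>
  proof -
    have "\<beta> \<in> dual_space H"
      using u \<beta> by (auto simp: weight_decomposition_def)
    then obtain h where h: "h \<in> H" "\<beta> h \<noteq> \<alpha> h"
      using dual_space_separate \<alpha> \<beta> by blast
    define y where "y = \<lbrakk>\<phi> h, x\<rbrakk>"
    have y: "y \<in> weight_space H \<alpha>"
    proof -
      have "\<lbrakk>k, y\<rbrakk> = \<alpha> k *s y" if "k \<in> H" for k
        using bracket_leibniz[of k "\<phi> h" x] weight_spaceD[OF central[OF h(1)] that]
          weight_spaceD[OF x that]
        by (simp add: y_def left.zero right.scale)
      then show ?thesis
        by (simp add: weight_space_def)
    qed
    have "\<alpha> h *s \<phi> x = y + \<lbrakk>h, \<phi> x\<rbrakk>"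
      using DerD(2)[OF \<phi>, of h x] weight_spaceD[OF x h(1)] by (simp add: \<phi>.scale y_def)
    moreover have "\<lbrakk>h, \<phi> x\<rbrakk> = (\<Sum>\<gamma>\<in>S. \<gamma> h *s u \<gamma>)"
      using weight_decomposition_bracket[OF u h(1)] by (simp add: weight_decomposition_def)
    moreover have "\<alpha> h *s \<phi> x = (\<Sum>\<gamma>\<in>S. \<alpha> h *s u \<gamma>)"
      using u by (simp add: weight_decomposition_def scale_sum_right)
    moreover have "(\<Sum>\<gamma>\<in>S. if \<gamma> = \<alpha> then y else 0) = y"
      using u by (simp add: sum.delta' weight_decomposition_def S_def)
    ultimately have "(\<Sum>\<gamma>\<in>S. (\<gamma> h - \<alpha> h) *s u \<gamma> + (if \<gamma> = \<alpha> then y else 0)) = 0"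
      by (simp add: sum.distrib sum_subtractf scale_left_diff_distrib algebra_simps)
    then have "(\<beta> h - \<alpha> h) *s u \<beta> + (if \<beta> = \<alpha> then y else 0) = 0"
      using u y \<beta>(1)
      by (intro weight_vectors_independent[of S H
            "\<lambda>\<gamma>. (\<gamma> h - \<alpha> h) *s u \<gamma> + (if \<gamma> = \<alpha> then y else 0)"])
        (auto simp: weight_decomposition_def
          intro!: subspace_add[OF subspace_weight_space] subspace_scale[OF subspace_weight_space]
            subspace_0[OF subspace_weight_space])
    then show ?thesis
      using \<beta>(2) h(2) by simp
  qed
  then have "(\<Sum>\<beta>\<in>S. u \<beta>) = (\<Sum>\<beta>\<in>{\<alpha>}. u \<beta>)"
    using u by (intro sum.mono_neutral_right) (auto simp: weight_decomposition_def S_def)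
  then show ?thesis
    using u by (simp add: weight_decomposition_def)
qed

theorem Der_eq_Der0_plus_Inn:
  assumes span: "span (\<Union>\<alpha>\<in>dual_space H. weight_space H \<alpha>) = UNIV"
    and B: "finite B" "B \<subseteq> H" "H \<subseteq> span B"
    and H: "abelian H"
  shows "Der = {\<phi> + \<psi> | \<phi> \<psi>. \<phi> \<in> Der0 H \<and> \<psi> \<in> Inn}"
proof (intro Set.equalityI subsetI)
  fix \<phi> assume "\<phi> \<in> {\<phi> + \<psi> | \<phi> \<psi>. \<phi> \<in> Der0 H \<and> \<psi> \<in> Inn}"
  then show "\<phi> \<in> Der"
    using Der_add Inn_subset_Der by (auto simp: Der0_def)
next
  fix \<phi> assume \<phi>: "\<phi> \<in> Der"
  interpret \<phi>: Vector_Spaces.linear scale scale \<phi>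
    using DerD(1)[OF \<phi>] .
  have cocycle: "\<lbrakk>h, \<phi> k\<rbrakk> = \<lbrakk>k, \<phi> h\<rbrakk>" if "h \<in> H" "k \<in> H" for h k
  proof -
    have "\<lbrakk>\<phi> h, k\<rbrakk> + \<lbrakk>h, \<phi> k\<rbrakk> = 0"
      using DerD(2)[OF \<phi>, of h k] H that by (simp add: abelian_def \<phi>.zero)
    then show ?thesis
      using bracket_antisym[of "\<phi> h" k] by simp
  qed
  obtain z where z: "\<And>h. h \<in> H \<Longrightarrow> \<phi> h - \<lbrakk>h, z\<rbrakk> \<in> weight_space H 0"
    using cocycle_coboundary_mod_centralizer[OF span B DerD(1)[OF \<phi>] cocycle] by blast
  let ?\<psi> = "\<lambda>x. \<lbrakk>x, z\<rbrakk>"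
  have \<psi>: "?\<psi> \<in> Inn"
    by (auto simp: Inn_def)
  have diff: "\<phi> - ?\<psi> \<in> Der"
    using \<phi> \<psi> Inn_subset_Der by (intro Der_diff) auto
  have "(\<phi> - ?\<psi>) x \<in> weight_space H \<alpha>"
    if "\<alpha> \<in> dual_space H" "x \<in> weight_space H \<alpha>" for \<alpha> x
    using derivation_preserves_weight_space[OF span diff _ that] z by simp
  then have "\<phi> - ?\<psi> \<in> Der0 H"
    using diff by (auto simp: Der0_def)
  moreover have "\<phi> = (\<phi> - ?\<psi>) + ?\<psi>"
    by simp
  ultimately show "\<phi> \<in> {\<phi> + \<psi> | \<phi> \<psi>. \<phi> \<in> Der0 H \<and> \<psi> \<in> Inn}"
    using \<psi> by blast
qed

section \<open>Weakly triangular decompositions\<close>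

lemma anti_involution_weight_space:
  assumes \<sigma>: "anti_involution \<sigma>" "\<And>h. h \<in> H \<Longrightarrow> \<sigma> h = h" and x: "x \<in> weight_space H \<alpha>"
  shows "\<sigma> x \<in> weight_space H (- \<alpha>)"
proof -
  interpret \<sigma>: Vector_Spaces.linear scale scale \<sigma>
    using \<sigma>(1) by (simp add: anti_involution_def)
  have "\<lbrakk>h, \<sigma> x\<rbrakk> = (- \<alpha>) h *s \<sigma> x" if "h \<in> H" for h
  proof -
    have "\<lbrakk>h, \<sigma> x\<rbrakk> = \<sigma> \<lbrakk>x, h\<rbrakk>"
      using \<sigma> that by (simp add: anti_involution_def)
    also have "\<lbrakk>x, h\<rbrakk> = - (\<alpha> h *s x)"
      using bracket_antisym[of x h] weight_spaceD[OF x that] by simp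
    finally show ?thesis
      by (simp add: \<sigma>.neg \<sigma>.scale)
  qed
  then show ?thesis
    by (simp add: weight_space_def)
qed

lemma abelian_subset_weight_space_0: "abelian H \<Longrightarrow> H \<subseteq> weight_space H 0"
  by (auto simp: abelian_def weight_space_def)

lemma span_weight_spaces_UNIV:
  assumes "weakly_triangular_decomposition Lm H Lp Gp"
  shows "span (\<Union>\<alpha>\<in>dual_space H. weight_space H \<alpha>) = UNIV" (is "?W = UNIV")
proof -
  have abelian: "abelian H" and Gp: "Gp \<subseteq> dual_space H"
    and total: "internal_direct_sum UNIV ((!) [Lm, H, Lp]) {..<3}"
    and Lp_sum: "internal_direct_sum Lp (\<lambda>\<alpha>. Lp \<inter> weight_space H \<alpha>) (Gp - {0})"
    using assms by (auto simp: weakly_triangular_decomposition_def)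
  obtain \<sigma> where \<sigma>: "anti_involution \<sigma>" "\<sigma> ` Lp = Lm" "\<And>h. h \<in> H \<Longrightarrow> \<sigma> h = h"
    using assms unfolding weakly_triangular_decomposition_def by blast
  have Lp_span: "Lp = span (\<Union>\<alpha>\<in>Gp - {0}. Lp \<inter> weight_space H \<alpha>)"
    using Lp_sum by (simp add: internal_direct_sum_def)
  have Lp: "Lp \<subseteq> ?W"
    by (subst Lp_span, rule span_mono) (use Gp in auto)
  have H: "H \<subseteq> ?W"
    using abelian_subset_weight_space_0[OF abelian] zero_in_dual_space by (blast intro: span_base)
  have "Lm \<subseteq> ?W"
  proof -
    interpret vector_space_pair scale scale
      by unfold_locales
    have "Vector_Spaces.linear (*s) (*s) \<sigma>"
      using \<sigma>(1) by (simp add: anti_involution_def)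
    then have "subspace (\<sigma> -` ?W)"
      by (rule linear_subspace_vimage) (rule subspace_span)
    moreover have "(\<Union>\<alpha>\<in>Gp - {0}. Lp \<inter> weight_space H \<alpha>) \<subseteq> \<sigma> -` ?W"
    proof
      fix x assume "x \<in> (\<Union>\<alpha>\<in>Gp - {0}. Lp \<inter> weight_space H \<alpha>)"
      then obtain \<alpha> where "\<alpha> \<in> dual_space H" "x \<in> weight_space H \<alpha>"
        using Gp by auto
      then have "\<sigma> x \<in> weight_space H (- \<alpha>)" "- \<alpha> \<in> dual_space H"
        using anti_involution_weight_space[of \<sigma> H x \<alpha>] \<sigma> uminus_in_dual_space by auto
      then show "x \<in> \<sigma> -` ?W"
        by (auto intro: span_base)
    qed
    ultimately have "Lp \<subseteq> \<sigma> -` ?W"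
      by (subst Lp_span) (rule span_minimal)
    then show ?thesis
      using \<sigma>(2) by auto
  qed
  with Lp H have "[Lm, H, Lp] ! i \<subseteq> ?W" if "i < 3" for i
    using that nth_mem[of i "[Lm, H, Lp]"] by auto
  then have "(\<Union>i\<in>{..<3}. [Lm, H, Lp] ! i) \<subseteq> ?W"
    by (intro UN_least) simp
  then have "span (\<Union>i\<in>{..<3}. [Lm, H, Lp] ! i) \<subseteq> ?W"
    by (rule span_minimal) (rule subspace_span)
  moreover have "UNIV = span (\<Union>i\<in>{..<3}. [Lm, H, Lp] ! i)"
    using total unfolding internal_direct_sum_def by (elim conjE)
  ultimately have "UNIV \<subseteq> ?W"
    by (rule ord_eq_le_trans[rotated])
  then show ?thesis
    by (rule top.extremum_uniqueI)
qed

text \<open>A spanning set of \<open>V\<close> need not meet \<open>W\<close>; a maximal independent subset of \<open>W\<close> does the job, and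
  is finite by the exchange lemma.\<close>

lemma finite_spanning_subset:
  assumes "finite_dim V" and "W \<subseteq> V"
  obtains B where "finite B" and "B \<subseteq> W" and "W \<subseteq> span B"
proof -
  obtain C where C: "finite C" "span C = V"
    using assms(1) by (auto simp: finite_dim_def)
  obtain B where B: "B \<subseteq> W" "independent B" "W \<subseteq> span B"
    using maximal_independent_subset[of W] by auto
  then have "finite B"
    using independent_span_bound[OF C(1) B(2)] C(2) assms(2) by auto
  with B show thesis
    using that by blast
qed

end

theorem proposition7p1:
  fixes scale :: "'f::field \<Rightarrow> 'l::ab_group_add \<Rightarrow> 'l"
    and bracket :: "'l \<Rightarrow> 'l \<Rightarrow> 'l"
    and Lm H Lp :: "'l set"
    and Gp :: "('l \<Rightarrow> 'f) set"
  assumes "lie_algebra scale bracket"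
    and "lie_algebra.regular_weakly_triangular_decomposition scale bracket Lm H Lp Gp"
    and "lie_algebra.completely_self_centralizing scale bracket Lp"
  shows "lie_algebra.Der scale bracket =
    {\<phi> + \<psi> | \<phi> \<psi>. \<phi> \<in> lie_algebra.Der0 scale bracket H \<and> \<psi> \<in> lie_algebra.Inn bracket}"
proof -
  interpret lie_algebra scale bracket
    by (rule assms(1))
  have wtd: "weakly_triangular_decomposition Lm H Lp Gp"
    and "finite_dim (weight_space H 0)"
    using assms(2) zero_in_dual_space by (auto simp: regular_weakly_triangular_decomposition_def)
  moreover have abelian: "abelian H"
    using wtd by (simp add: weakly_triangular_decomposition_def)
  ultimately obtain B where "finite B" "B \<subseteq> H" "H \<subseteq> span B"
    using finite_spanning_subset abelian_subset_weight_space_0 by metis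
  then show ?thesis
    using Der_eq_Der0_plus_Inn span_weight_spaces_UNIV[OF wtd] abelian by blast
qed

end
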